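(* Let $\mathcal I=\{I_n\}_{n\in\mathbb N}$ be a filtration in a local ring $R$ with maximal ideal $m_R$. Then $\ell(\mathcal I)=0$ if and only if for all $n>0$ and all $f\in I_n$ there exists $m>0$ such that $f^m\in m_RI_{mn}$.
   Context: Local rings are Noetherian. A filtration $\mathcal I=\{I_n\}_{n\in\mathbb N}$ on a ring $R$ is a descending chain of ideals $R=I_0\supset I_1\supset I_2\supset\cdots$ with $I_iI_j\subset I_{i+j}$ for all $i,j$. Its Rees ring is $R[\mathcal I]=\sum_{n\ge 0}I_nt^n\subset R[t]$ (not assumed Noetherian). For $R$ local with maximal ideal $m_R$, the analytic spread is $\ell(\mathcal I)=\dim R[\mathcal I]/m_RR[\mathcal I]$ (Krull dimension). *)

theory Defs
  imports "HOL-Algebra.Algebra" "HOL-Library.Extended_Real"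
begin

locale local_noetherian_ring = cring R + noetherian_ring R for R (structure) +
  fixes M
  assumes maximal: "maximalideal M R"
    and maximal_unique: "maximalideal J R \<Longrightarrow> J = M"

locale ring_filtration = cring R for R (structure) +
  fixes I :: "nat \<Rightarrow> 'a set"
  assumes filtration_ideal: "ideal (I n) R"
    and filtration_0: "I 0 = carrier R"
    and filtration_descending: "I (Suc n) \<subseteq> I n"
    and filtration_mult: "ideal_prod R (I i) (I j) \<subseteq> I (i + j)"

text \<open>
  The Rees ring, as a subring of the polynomial ring: the polynomials whose coefficient
  of degree \<open>n\<close> lies in \<open>I n\<close>. Only the carrier is restricted.
\<close>
definition rees_ring :: "('a, 'b) ring_scheme \<Rightarrow> (nat \<Rightarrow> 'a set) \<Rightarrow> ('a, nat \<Rightarrow> 'a) up_ring"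
  where "rees_ring R I =
    (UP R)\<lparr>carrier := {p \<in> carrier (UP R). \<forall>n. coeff (UP R) p n \<in> I n}\<rparr>"

text \<open>
  Supremum of the lengths of strictly increasing chains of prime ideals; the zero ring
  gets dimension \<open>-\<infinity>\<close>.
\<close>
definition krull_dim :: "('a, 'b) ring_scheme \<Rightarrow> ereal"
  where "krull_dim R = Sup {ereal (real n) | n.
    \<exists>P :: nat \<Rightarrow> 'a set. (\<forall>i\<le>n. primeideal (P i) R) \<and> (\<forall>i<n. P i \<subset> P (Suc i))}"

text \<open>
  \<open>M\<close> is extended to the Rees ring as the ideal generated by the constant polynomials
  with value in \<open>M\<close>.
\<close>
definition analytic_spread :: "('a, 'b) ring_scheme \<Rightarrow> 'a set \<Rightarrow> (nat \<Rightarrow> 'a set) \<Rightarrow> ereal"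
  where "analytic_spread R M I =
    krull_dim (rees_ring R I Quot
      (Idl\<^bsub>rees_ring R I\<^esub> ((\<lambda>a. monom (UP R) a 0) ` M)))"

end

theory Submission
  imports Defs
begin

section \<open>Prime ideals and dimension zero\<close>

text \<open>Write B for R[I] / M R[I]. The degree n part of the ideal M R[I] is exactly M I_n
  (\<open>coeff_J\<close>, \<open>monom_in_J\<close>), so B is graded with degree n part I_n / M
  I_n, and its degree 0 part is the field R/M. For f in I_n, the condition f^m in M I_(mn) says that
  the class of f t^n in B has m-th power zero. The theorem thus says that B has dimension 0 if and
  only if every homogeneous element of positive degree is nilpotent.

  If B has dimension 0, every x in B satisfies x^k = x^(k+1) y for some k and y
  (\<open>krull_dim_0_imp_pow_eq\<close>), an argument valid in any commutative ring, which matters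
  because B may fail to be Noetherian. For x homogeneous of positive degree the two sides share no
  degree, so x^k = 0 (\<open>pow_mem_if_krull_dim_0\<close>).

  Conversely, if these elements are nilpotent, every prime of B contains all of positive degree, and
  modulo that part B is the field R/M. So no prime lies strictly inside another
  (\<open>krull_dim_0_if_pow_mem\<close>). Since 1 is not in M R[I], B has a prime, and its
  dimension is 0 rather than -infinity.\<close>

lemma (in cring) mem_ideal_add_cgenideal:
  assumes "ideal P R" "a \<in> carrier R"
  shows "s \<in> P <+>\<^bsub>R\<^esub> PIdl a \<longleftrightarrow> (\<exists>p\<in>P. \<exists>r\<in>carrier R. s = p \<oplus> r \<otimes> a)"
  unfolding set_add_def' cgenideal_def by blast

lemma (in cring) ideal_add_cgenideal:
  assumes "ideal P R" "a \<in> carrier R"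
  shows "ideal (P <+>\<^bsub>R\<^esub> PIdl a) R" "P \<subseteq> P <+>\<^bsub>R\<^esub> PIdl a" "a \<in> P <+>\<^bsub>R\<^esub> PIdl a"
proof -
  interpret ideal P R by fact
  note mem = mem_ideal_add_cgenideal[OF assms]
  show "ideal (P <+>\<^bsub>R\<^esub> PIdl a) R"
    by (simp add: add_ideals assms cgenideal_ideal)
  show "P \<subseteq> P <+>\<^bsub>R\<^esub> PIdl a"
  proof
    fix p assume p: "p \<in> P"
    then have "p = p \<oplus> \<zero> \<otimes> a"
      using assms by (simp add: Icarr)
    with p show "p \<in> P <+>\<^bsub>R\<^esub> PIdl a"
      unfolding mem by (intro bexI) auto
  qed
  have "a = \<zero> \<oplus> \<one> \<otimes> a"
    using assms by simp
  then show "a \<in> P <+>\<^bsub>R\<^esub> PIdl a"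
    unfolding mem by (intro bexI) (auto intro: additive_subgroup.zero_closed is_additive_subgroup)
qed

text \<open>Zorn's lemma gives an ideal P maximal among those that contain I and miss S. If a and b
  were outside P with ab in P, then P + (a) and P + (b) would both meet S, and the product of two
  such elements would lie in both P and S. The last conclusion exports the maximality of P: for S =
  {1} it turns P into a maximal ideal.\<close>

lemma (in cring) prime_avoiding_multiplicative_set:
  assumes I: "ideal I R" and disj: "I \<inter> S = {}"
    and one: "\<one> \<in> S" and S: "S \<subseteq> carrier R"
    and mult: "\<And>s t. \<lbrakk>s \<in> S; t \<in> S\<rbrakk> \<Longrightarrow> s \<otimes> t \<in> S"
  obtains P where "primeideal P R" "I \<subseteq> P" "P \<inter> S = {}"
    "\<And>J. \<lbrakk>ideal J R; P \<subset> J\<rbrakk> \<Longrightarrow> J \<inter> S \<noteq> {}"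
proof -
  define \<A> where "\<A> = {J. ideal J R \<and> I \<subseteq> J \<and> J \<inter> S = {}}"
  have "\<exists>P\<in>\<A>. \<forall>Y\<in>\<A>. P \<subseteq> Y \<longrightarrow> Y = P"
  proof (rule subset_Zorn_nonempty)
    show "\<A> \<noteq> {}"
      using I disj unfolding \<A>_def by blast
  next
    fix C assume C: "C \<noteq> {}" "subset.chain \<A> C"
    then have "subset.chain {J. ideal J R} C"
      unfolding pred_on.chain_def \<A>_def by blast
    from chain_Union_is_ideal[OF this] C(1) have "ideal (\<Union>C) R"
      by simp
    moreover have "\<forall>Y\<in>C. I \<subseteq> Y \<and> Y \<inter> S = {}"
      using C(2) unfolding pred_on.chain_def \<A>_def by auto
    then have "I \<subseteq> \<Union>C" "\<Union>C \<inter> S = {}"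
      using C(1) by fast+
    ultimately show "\<Union>C \<in> \<A>"
      unfolding \<A>_def by simp
  qed
  then obtain P where PA: "P \<in> \<A>" and max: "\<forall>Y\<in>\<A>. P \<subseteq> Y \<longrightarrow> Y = P" ..
  then have P: "ideal P R" "I \<subseteq> P" "P \<inter> S = {}"
    unfolding \<A>_def by auto
  interpret ideal P R by (rule P(1))
  have meets: "J \<inter> S \<noteq> {}" if J: "ideal J R" "P \<subset> J" for J
  proof
    assume "J \<inter> S = {}"
    then have "J \<in> \<A>"
      using J P(2) unfolding \<A>_def by auto
    with max J(2) show False by auto
  qed
  have ex: "\<exists>p\<in>P. \<exists>r\<in>carrier R. p \<oplus> r \<otimes> a \<in> S" if "a \<in> carrier R" "a \<notin> P" for a
  proof -
    note Pa = ideal_add_cgenideal[OF P(1) that(1)]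
    have "P \<subset> P <+>\<^bsub>R\<^esub> PIdl a"
      using Pa(2,3) that(2) by blast
    from meets[OF Pa(1) this] obtain s where "s \<in> P <+>\<^bsub>R\<^esub> PIdl a" "s \<in> S"
      by blast
    then show ?thesis
      unfolding mem_ideal_add_cgenideal[OF P(1) that(1)] by blast
  qed
  have "primeideal P R"
  proof (rule primeidealI)
    show "ideal P R" by (rule P(1))
    show "cring R" by (rule is_cring)
    show "carrier R \<noteq> P"
      using one P(3) by blast
  next
    fix a b assume ab: "a \<in> carrier R" "b \<in> carrier R" "a \<otimes> b \<in> P"
    show "a \<in> P \<or> b \<in> P"
    proof (rule ccontr)
      assume "\<not> ?thesis"
      then obtain p r q s where pr: "p \<in> P" "r \<in> carrier R" "p \<oplus> r \<otimes> a \<in> S"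
        and qs: "q \<in> P" "s \<in> carrier R" "q \<oplus> s \<otimes> b \<in> S"
        using ex[OF ab(1)] ex[OF ab(2)] by blast
      note [simp] = Icarr[OF pr(1)] Icarr[OF qs(1)] pr(2) qs(2) ab(1,2)
      \<comment> \<open>The expansion is grouped so that each summand has a factor in P: p, q, or a
        b.\<close>
      have "(p \<oplus> r \<otimes> a) \<otimes> (q \<oplus> s \<otimes> b) =
          p \<otimes> (q \<oplus> s \<otimes> b) \<oplus> ((r \<otimes> a) \<otimes> q \<oplus> (r \<otimes> s) \<otimes> (a \<otimes> b))"
        by (simp add: l_distr r_distr m_ac a_ac)
      also have "\<dots> \<in> P"
        by (intro a_closed I_r_closed[OF pr(1)] I_l_closed[OF qs(1)] I_l_closed[OF ab(3)]) simp_all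
      finally show False
        using mult[OF pr(3) qs(3)] P(3) by blast
    qed
  qed
  then show thesis
    by (rule that) (use P meets in auto)
qed

lemma (in cring) maximalideal_exists:
  assumes "ideal I R" "\<one> \<notin> I"
  obtains P where "maximalideal P R" "I \<subseteq> P"
proof -
  obtain P where P: "primeideal P R" "I \<subseteq> P" "P \<inter> {\<one>} = {}"
    and max: "\<And>J. \<lbrakk>ideal J R; P \<subset> J\<rbrakk> \<Longrightarrow> J \<inter> {\<one>} \<noteq> {}"
    by (rule prime_avoiding_multiplicative_set[of I "{\<one>}"]) (use assms in auto)
  interpret P: primeideal P R by fact
  have "maximalideal P R"
  proof (rule maximalidealI)
    fix J assume J: "ideal J R" "P \<subseteq> J" "J \<subseteq> carrier R"
    show "J = P \<or> J = carrier R"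
    proof (cases "J = P")
      case False
      with J have "\<one> \<in> J"
        using max[of J] by auto
      then show ?thesis
        using ideal.one_imp_carrier[OF J(1)] by simp
    qed simp
  qed (use P.I_notcarr P.is_ideal in auto)
  then show thesis
    using P(2) by (rule that)
qed

lemma (in primeideal) pow_memD:
  assumes "x \<in> carrier R" "x [^] (n::nat) \<in> I"
  shows "x \<in> I"
  using assms(2)
proof (induction n)
  case 0
  then show ?case
    using one_imp_carrier I_notcarr by simp
next
  case (Suc n)
  then show ?case
    using I_prime[of "x [^] n" x] assms(1) by auto
qed

text \<open>Any chain of positive length begins with a strict inclusion of two primes, so forbidding
  these leaves only length 0. The existence of a prime keeps the supremum from being taken over the
  empty set, where it is -infinity.\<close>

lemma krull_dim_eq_0_iff:
  "krull_dim R = 0 \<longleftrightarrow>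
    (\<exists>P. primeideal P R) \<and> (\<forall>P Q. primeideal P R \<and> primeideal Q R \<longrightarrow> \<not> P \<subset> Q)"
proof
  let ?S = "{ereal (real n) | n.
    \<exists>P :: nat \<Rightarrow> 'a set. (\<forall>i\<le>n. primeideal (P i) R) \<and> (\<forall>i<n. P i \<subset> P (Suc i))}"
  assume dim: "krull_dim R = 0"
  have "\<exists>P. primeideal P R"
  proof (rule ccontr)
    assume "\<not> ?thesis"
    then have "?S = {}" by blast
    then have "krull_dim R = Sup {}"
      unfolding krull_dim_def by (rule arg_cong)
    then show False
      using dim by (simp add: bot_ereal_def)
  qed
  moreover have "\<not> P \<subset> Q" if PQ: "primeideal P R" "primeideal Q R" for P Q
  proof
    assume "P \<subset> Q"
    then have "ereal (real 1) \<in> ?S"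
      using PQ by (intro CollectI exI[of _ 1] conjI exI[of _ "\<lambda>i::nat. if i = 0 then P else Q"]) auto
    then have "ereal (real 1) \<le> krull_dim R"
      unfolding krull_dim_def by (rule Sup_upper)
    then show False
      using dim by simp
  qed
  ultimately show "(\<exists>P. primeideal P R) \<and> (\<forall>P Q. primeideal P R \<and> primeideal Q R \<longrightarrow> \<not> P \<subset> Q)"
    by blast
next
  let ?S = "{ereal (real n) | n.
    \<exists>P :: nat \<Rightarrow> 'a set. (\<forall>i\<le>n. primeideal (P i) R) \<and> (\<forall>i<n. P i \<subset> P (Suc i))}"
  assume *: "(\<exists>P. primeideal P R) \<and> (\<forall>P Q. primeideal P R \<and> primeideal Q R \<longrightarrow> \<not> P \<subset> Q)"
  have "?S = {0}"
  proof (intro equalityI subsetI)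
    fix x assume "x \<in> ?S"
    then obtain n and P :: "nat \<Rightarrow> 'a set" where n: "x = ereal (real n)"
      "\<forall>i\<le>n. primeideal (P i) R" "\<forall>i<n. P i \<subset> P (Suc i)"
      by blast
    have "n = 0"
    proof (rule ccontr)
      assume "n \<noteq> 0"
      then have "primeideal (P 0) R" "primeideal (P (Suc 0)) R" "P 0 \<subset> P (Suc 0)"
        using n by auto
      with * show False by blast
    qed
    with n show "x \<in> {0}" by simp
  next
    fix x :: ereal assume "x \<in> {0}"
    moreover obtain P where "primeideal P R"
      using * by blast
    ultimately show "x \<in> ?S"
      by (intro CollectI exI[of _ 0] conjI exI[of _ "\<lambda>_. P"]) (auto simp: zero_ereal_def)
  qed
  then have "krull_dim R = Sup {0}"
    unfolding krull_dim_def by (rule arg_cong)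
  then show "krull_dim R = 0"
    by simp
qed

text \<open>
  If no such \<open>k\<close> and \<open>y\<close> existed, a prime \<open>P\<close> avoiding all \<open>x\<^sup>k (1 + x y)\<close> would not contain
  \<open>x\<close>, although \<open>P + (x)\<close> is proper; a prime containing \<open>P + (x)\<close> is then strictly larger than \<open>P\<close>.
\<close>
lemma (in cring) krull_dim_0_imp_pow_eq:
  assumes dim: "krull_dim R = 0" and x: "x \<in> carrier R"
  obtains k :: nat and y where "y \<in> carrier R" "x [^] k = x [^] Suc k \<otimes> y"
proof (rule ccontr)
  assume neg: "\<not> thesis"
  define S where "S = {x [^] (k::nat) \<otimes> (\<one> \<oplus> x \<otimes> y) | k y. y \<in> carrier R}"
  have disj: "{\<zero>} \<inter> S = {}"
  proof (rule ccontr)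
    assume "{\<zero>} \<inter> S \<noteq> {}"
    then have "\<zero> \<in> S"
      by auto
    then obtain k y where ky: "y \<in> carrier R" "x [^] (k::nat) \<otimes> (\<one> \<oplus> x \<otimes> y) = \<zero>"
      unfolding S_def by auto
    then have "x [^] k \<oplus> x [^] Suc k \<otimes> y = \<zero>"
      using x by (simp add: r_distr m_assoc)
    then have "x [^] k = \<ominus> (x [^] Suc k \<otimes> y)"
      using minus_equality[of "x [^] k" "x [^] Suc k \<otimes> y"] x ky(1) by (simp del: nat_pow_Suc)
    also have "\<dots> = x [^] Suc k \<otimes> \<ominus> y"
      using x ky(1) by (simp add: r_minus)
    finally have "x [^] k = x [^] Suc k \<otimes> \<ominus> y" .
    with neg that[of "\<ominus> y" k] ky(1) show False by blast
  qed
  have mult: "s \<otimes> t \<in> S" if "s \<in> S" "t \<in> S" for s t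
  proof -
    from that obtain k y l z where st: "y \<in> carrier R" "z \<in> carrier R"
      "s = x [^] (k::nat) \<otimes> (\<one> \<oplus> x \<otimes> y)" "t = x [^] (l::nat) \<otimes> (\<one> \<oplus> x \<otimes> z)"
      unfolding S_def by blast
    have "(\<one> \<oplus> x \<otimes> y) \<otimes> (\<one> \<oplus> x \<otimes> z) = \<one> \<oplus> x \<otimes> (y \<oplus> z \<oplus> x \<otimes> y \<otimes> z)"
      using x st by (simp add: l_distr r_distr m_ac a_ac)
    moreover have "s \<otimes> t = x [^] (k + l) \<otimes> ((\<one> \<oplus> x \<otimes> y) \<otimes> (\<one> \<oplus> x \<otimes> z))"
      using x st by (simp add: nat_pow_mult[symmetric] m_ac)
    ultimately show ?thesis
      unfolding S_def using x st(1,2)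
      by (intro CollectI exI[of _ "k + l"] exI[of _ "y \<oplus> z \<oplus> x \<otimes> y \<otimes> z"]) simp
  qed
  have SI: "x [^] k \<otimes> (\<one> \<oplus> x \<otimes> y) \<in> S" if "y \<in> carrier R" for k :: nat and y
    unfolding S_def using that by blast
  have one: "\<one> \<in> S"
    using SI[of \<zero> 0] x by simp
  have SR: "S \<subseteq> carrier R"
    unfolding S_def using x by auto
  obtain P where P: "primeideal P R" "P \<inter> S = {}"
    by (rule prime_avoiding_multiplicative_set[OF zeroideal disj one SR mult])
  interpret P: primeideal P R by fact
  note J = ideal_add_cgenideal[OF P.is_ideal x]
  have "\<one> \<notin> P <+>\<^bsub>R\<^esub> PIdl x"
  proof
    assume "\<one> \<in> P <+>\<^bsub>R\<^esub> PIdl x"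
    then obtain p r where pr: "p \<in> P" "r \<in> carrier R" "\<one> = p \<oplus> r \<otimes> x"
      using mem_ideal_add_cgenideal[OF P.is_ideal x] by blast
    \<comment> \<open>Solved for p, the equation 1 = p + r x exhibits p as the element 1 + x (-r) of
      \<open>S\<close>, with exponent 0.\<close>
    have "p = (p \<oplus> r \<otimes> x) \<oplus> \<ominus> (r \<otimes> x)"
      using x pr(2) P.Icarr[OF pr(1)] by (simp add: a_assoc r_neg)
    also have "\<dots> = x [^] (0::nat) \<otimes> (\<one> \<oplus> x \<otimes> \<ominus> r)"
      unfolding pr(3)[symmetric] using x pr(2) by (simp add: m_comm r_minus)
    finally show False
      using SI[of "\<ominus> r" 0] P(2) pr by blast
  qed
  then obtain Q where Q: "maximalideal Q R" "P <+>\<^bsub>R\<^esub> PIdl x \<subseteq> Q"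
    by (rule maximalideal_exists[OF J(1)])
  have "x \<notin> P"
    using SI[of \<zero> 1] P(2) x by auto
  then have "P \<subset> Q"
    using J(2,3) Q(2) by blast
  then show False
    using dim P(1) maximalideal_prime[OF Q(1)] unfolding krull_dim_eq_0_iff by blast
qed

text \<open>Otherwise the proper ideal (a) would lie in a maximal ideal, and the only one is
  M.\<close>

lemma (in local_noetherian_ring) inverse_if_notin_maximal:
  assumes a: "a \<in> carrier R" "a \<notin> M"
  obtains b where "b \<in> carrier R" "b \<otimes> a = \<one>"
proof -
  have "\<one> \<in> PIdl a"
  proof (rule ccontr)
    assume "\<one> \<notin> PIdl a"
    then obtain Q where "maximalideal Q R" "PIdl a \<subseteq> Q"
      by (rule maximalideal_exists[OF cgenideal_ideal[OF a(1)]])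
    then show False
      using maximal_unique cgenideal_self[OF a(1)] a(2) by auto
  qed
  then show thesis
    using that unfolding cgenideal_def by force
qed

section \<open>The Rees ring\<close>

locale local_filtration = local_noetherian_ring R M + ring_filtration R I
  for R (structure) and M and I

sublocale local_filtration \<subseteq> UP: UP_cring R "UP R"
  by (intro UP_cring.intro) (rule is_cring)

context local_filtration
begin

text \<open>
  In a ring context the bare names \<open>monom\<close> and \<open>coeff\<close> denote the list polynomials of
  \<^theory>\<open>HOL-Algebra.Polynomials\<close>.
\<close>
abbreviation "mnm \<equiv> up_ring.monom (UP R)"
abbreviation "cof \<equiv> up_ring.coeff (UP R)"
abbreviation "A \<equiv> rees_ring R I"
abbreviation "J \<equiv> Idl\<^bsub>A\<^esub> ((\<lambda>a. mnm a 0) ` M)"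

lemma mem_rees_iff:
  "p \<in> carrier A \<longleftrightarrow> p \<in> carrier (UP R) \<and> (\<forall>n. cof p n \<in> I n)"
  by (simp add: rees_ring_def)

lemma rees_simps [simp]:
  "p \<otimes>\<^bsub>A\<^esub> q = p \<otimes>\<^bsub>UP R\<^esub> q" "p \<oplus>\<^bsub>A\<^esub> q = p \<oplus>\<^bsub>UP R\<^esub> q"
  "\<one>\<^bsub>A\<^esub> = \<one>\<^bsub>UP R\<^esub>" "\<zero>\<^bsub>A\<^esub> = \<zero>\<^bsub>UP R\<^esub>"
  by (simp_all add: rees_ring_def)

lemma rees_pow [simp]: "p [^]\<^bsub>A\<^esub> (n::nat) = p [^]\<^bsub>UP R\<^esub> n"
  by (simp add: nat_pow_def)

lemma filtration_carrier: "a \<in> I n \<Longrightarrow> a \<in> carrier R"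
  using ideal.Icarr[OF filtration_ideal] .

lemma rees_closed: "p \<in> carrier A \<Longrightarrow> p \<in> carrier (UP R)"
  by (simp add: mem_rees_iff)

lemma mult_mem_filtration: "\<lbrakk>a \<in> I i; b \<in> I j\<rbrakk> \<Longrightarrow> a \<otimes> b \<in> I (i + j)"
  using ideal_prod.prod[of a "I i" b "I j" R] filtration_mult by blast

lemma filtration_zero: "\<zero> \<in> I n"
  using filtration_ideal[of n] by (simp add: additive_subgroup.zero_closed ideal_def)

lemma monom_in_rees: "a \<in> I n \<Longrightarrow> mnm a n \<in> carrier A"
  by (simp add: mem_rees_iff filtration_carrier filtration_zero)

lemma finsum_in_ideal:
  assumes "ideal K R" "finite S" "\<And>i. i \<in> S \<Longrightarrow> f i \<in> K"
  shows "finsum R f S \<in> K"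
  using assms(2,3)
proof (induction S rule: finite_induct)
  case empty
  then show ?case
    using assms(1) by (simp add: additive_subgroup.zero_closed ideal_def)
next
  case (insert i S)
  interpret K: ideal K R by fact
  show ?case
    using insert by (subst finsum_insert) (auto intro: K.Icarr K.a_closed)
qed

text \<open>The family K is kept general to serve twice: K = I shows that the Rees ring is closed
  under products, and other K give its graded ideals.\<close>

lemma coeff_mult_mem:
  assumes K: "\<And>n. ideal (K n) R" and IK: "\<And>i j a b. \<lbrakk>a \<in> I i; b \<in> K j\<rbrakk> \<Longrightarrow> a \<otimes> b \<in> K (i + j)"
    and p: "p \<in> carrier A" and q: "q \<in> carrier (UP R)" "\<And>n. cof q n \<in> K n"
  shows "cof (p \<otimes>\<^bsub>UP R\<^esub> q) n \<in> K n"
proof -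
  have "cof p i \<otimes> cof q (n - i) \<in> K n" if "i \<le> n" for i
    using IK[of "cof p i" i "cof q (n - i)" "n - i"] p q that
    by (simp add: mem_rees_iff)
  then show ?thesis
    using p q by (auto simp: mem_rees_iff intro: finsum_in_ideal[OF K])
qed

lemma rees_subring: "subring (carrier A) (UP R)"
proof (rule UP.P.subringI)
  show "carrier A \<subseteq> carrier (UP R)"
    by (auto simp: mem_rees_iff)
  show "\<one>\<^bsub>UP R\<^esub> \<in> carrier A"
    by (simp add: mem_rees_iff filtration_0 filtration_zero)
next
  fix p assume "p \<in> carrier A"
  then show "\<ominus>\<^bsub>UP R\<^esub> p \<in> carrier A"
    using additive_subgroup.a_inv_closed[OF ideal.axioms(1)[OF filtration_ideal]]
    by (simp add: mem_rees_iff)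
next
  fix p q assume pq: "p \<in> carrier A" "q \<in> carrier A"
  show "p \<otimes>\<^bsub>UP R\<^esub> q \<in> carrier A"
    using coeff_mult_mem[of I p q] pq filtration_ideal mult_mem_filtration
    by (auto simp: mem_rees_iff simp del: UP.coeff_mult)
  show "p \<oplus>\<^bsub>UP R\<^esub> q \<in> carrier A"
    using pq additive_subgroup.a_closed[OF ideal.axioms(1)[OF filtration_ideal]]
    by (simp add: mem_rees_iff)
qed

lemma rees_eq: "A = (UP R)\<lparr>carrier := carrier A\<rparr>"
  by (simp add: rees_ring_def)

lemma rees_cring: "cring A"
  using UP.P.subcring_iff[of "carrier A"] UP.P.subcringI'[OF rees_subring] rees_eq rees_closed by auto

sublocale A: cring A
  by (rule rees_cring)

section \<open>Graded ideals of the Rees ring and the extension of the maximal ideal\<close>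

lemma maximal_ideal: "ideal M R"
  using maximal by (simp add: maximalideal_def)

lemma rees_ideal_if:
  assumes K: "\<And>n. ideal (K n) R" and IK: "\<And>i j a b. \<lbrakk>a \<in> I i; b \<in> K j\<rbrakk> \<Longrightarrow> a \<otimes> b \<in> K (i + j)"
  shows "ideal {p \<in> carrier A. \<forall>n. cof p n \<in> K n} A" (is "ideal ?L A")
proof -
  note K' = ideal.axioms(1)[OF K]
  have mult: "x \<otimes>\<^bsub>A\<^esub> a \<in> ?L" if a: "a \<in> ?L" and x: "x \<in> carrier A" for a x
  proof (intro CollectI conjI allI)
    show "x \<otimes>\<^bsub>A\<^esub> a \<in> carrier A"
      using a by (intro A.m_closed[OF x]) simp
    fix n show "cof (x \<otimes>\<^bsub>A\<^esub> a) n \<in> K n"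
      unfolding rees_simps by (rule coeff_mult_mem[of K x a, OF K IK x]) (use a rees_closed in auto)
  qed
  show ?thesis
  proof (rule idealI)
    show "ring A" by (rule A.ring_axioms)
    show "subgroup ?L (add_monoid A)"
    proof (rule A.add.subgroupI)
      have "\<zero>\<^bsub>A\<^esub> \<in> ?L"
        using additive_subgroup.zero_closed[OF K'] A.zero_closed by simp
      then show "?L \<noteq> {}" by auto
    next
      fix a assume a: "a \<in> ?L"
      have "a \<in> carrier A"
        using a by simp
      \<comment> \<open>The negative in \<open>A\<close> is determined by the restricted carrier and
        is not rewritten by \<open>rees_simps\<close>; as (-1) a it is covered by the closure
        \<open>mult\<close>.\<close>
      then have eq: "\<ominus>\<^bsub>A\<^esub> a = \<ominus>\<^bsub>A\<^esub> \<one>\<^bsub>A\<^esub> \<otimes>\<^bsub>A\<^esub> a"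
        using A.l_minus[OF A.one_closed, of a] A.l_one[of a] by simp
      show "\<ominus>\<^bsub>A\<^esub> a \<in> ?L"
        unfolding eq by (rule mult[OF a A.a_inv_closed[OF A.one_closed]])
    next
      fix a b assume "a \<in> ?L" "b \<in> ?L"
      then show "a \<oplus>\<^bsub>A\<^esub> b \<in> ?L"
        using A.a_closed[of a b] additive_subgroup.a_closed[OF K'] by (auto simp: rees_closed)
    qed auto
  next
    fix a x assume a: "a \<in> ?L" and x: "x \<in> carrier A"
    have eq: "a \<otimes>\<^bsub>A\<^esub> x = x \<otimes>\<^bsub>A\<^esub> a"
      using a by (intro A.m_comm[OF _ x]) simp
    show "a \<otimes>\<^bsub>A\<^esub> x \<in> ?L"
      unfolding eq by (rule mult[OF a x])
  qed (rule mult)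
qed

lemma gens_in_rees: "(\<lambda>a. mnm a 0) ` M \<subseteq> carrier A"
  using monom_in_rees[of _ 0] filtration_0 ideal.Icarr[OF maximal_ideal] by auto

lemma J_ideal: "ideal J A"
  by (rule A.genideal_ideal[OF gens_in_rees])

lemma const_in_J: "a \<in> M \<Longrightarrow> mnm a 0 \<in> J"
  by (rule subsetD[OF A.genideal_self[OF gens_in_rees] imageI])

text \<open>The polynomials whose coefficient of degree n lies in M I_n form an ideal of the Rees
  ring by \<open>rees_ideal_if\<close>. It contains the generators of \<open>J\<close>, hence
  \<open>J\<close> itself.\<close>

lemma coeff_J:
  assumes "p \<in> J"
  shows "cof p n \<in> ideal_prod R M (I n)"
proof -
  let ?K = "\<lambda>n. ideal_prod R M (I n)"
  let ?L = "{p \<in> carrier A. \<forall>n. cof p n \<in> ?K n}"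
  have K: "ideal (?K n) R" for n
    by (rule ideal_prod_is_ideal[OF maximal_ideal filtration_ideal])
  have IK: "a \<otimes> b \<in> ?K (i + j)" if a: "a \<in> I i" and b: "b \<in> ?K j" for i j a b
    using b
  proof (induction b)
    case (prod m c)
    have "m \<otimes> (a \<otimes> c) \<in> ?K (i + j)"
      by (rule ideal_prod.prod[OF prod(1) mult_mem_filtration[OF a prod(2)]])
    also have "m \<otimes> (a \<otimes> c) = a \<otimes> (m \<otimes> c)"
      using ideal.Icarr[OF maximal_ideal prod(1)] filtration_carrier[OF a] filtration_carrier[OF prod(2)]
      by (rule m_lcomm)
    finally show ?case .
  next
    case (sum s t)
    have "a \<otimes> (s \<oplus> t) = a \<otimes> s \<oplus> a \<otimes> t"
      using ideal.Icarr[OF K sum(1)] ideal.Icarr[OF K sum(2)] filtration_carrier[OF a] by (rule r_distr)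
    then show ?case
      using ideal_prod.sum[OF sum.IH] by simp
  qed
  have "mnm a 0 \<in> ?L" if a: "a \<in> M" for a
  proof (intro CollectI conjI allI)
    show "mnm a 0 \<in> carrier A"
      by (rule subsetD[OF gens_in_rees imageI[OF a]])
    fix n
    have aR: "a \<in> carrier R"
      by (rule ideal.Icarr[OF maximal_ideal a])
    \<comment> \<open>Since I_0 = R, the factor 1 places a in M I_0.\<close>
    have "a \<otimes> \<one> \<in> ?K 0"
      using a filtration_0 by (intro ideal_prod.prod) simp_all
    then show "cof (mnm a 0) n \<in> ?K n"
      using aR additive_subgroup.zero_closed[OF ideal.axioms(1)[OF K], of n] by simp
  qed
  then have "J \<subseteq> ?L"
    by (intro A.genideal_minimal[OF rees_ideal_if[of ?K, OF K IK]] image_subsetI)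
  from subsetD[OF this assms] show ?thesis by simp
qed

text \<open>For a generator m c of M I_n, the monomial m c t^n is the product of the constant m in
  \<open>J\<close> and the element c t^n of the Rees ring.\<close>

lemma monom_in_J:
  assumes "a \<in> ideal_prod R M (I n)"
  shows "mnm a n \<in> J"
  using assms
proof (induction a)
  case (prod m c)
  have "mnm m 0 \<otimes>\<^bsub>A\<^esub> mnm c n \<in> J"
    by (rule ideal.I_r_closed[OF J_ideal const_in_J[OF prod(1)] monom_in_rees[OF prod(2)]])
  moreover have "mnm m 0 \<otimes>\<^bsub>A\<^esub> mnm c n = mnm (m \<otimes> c) n"
    using UP.monom_mult[of m c 0 n] filtration_carrier[OF prod(2)] ideal.Icarr[OF maximal_ideal prod(1)]
    by simp
  ultimately show ?case by simp
next
  case (sum s t)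
  have "s \<in> carrier R" "t \<in> carrier R"
    using sum(1,2) by (simp_all add: subsetD[OF ideal_prod_in_carrier[OF maximal_ideal filtration_ideal]])
  then show ?case
    using additive_subgroup.a_closed[OF ideal.axioms(1)[OF J_ideal] sum.IH] by simp
qed

text \<open>The product lies in the proper ideal M. In degree 0 this makes \<open>J\<close> proper
  and later forces a positive exponent.\<close>

lemma one_notin_maximal_prod: "\<one> \<notin> ideal_prod R M (I n)"
proof
  assume "\<one> \<in> ideal_prod R M (I n)"
  then have "\<one> \<in> M"
    using subsetD[OF ideal_prod_inter[OF maximal_ideal filtration_ideal]] by simp
  then show False
    using maximalideal.I_notcarr[OF maximal] ideal.one_imp_carrier[OF maximal_ideal] by simp
qed

lemma one_notin_J: "\<one>\<^bsub>A\<^esub> \<notin> J"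
proof
  assume "\<one>\<^bsub>A\<^esub> \<in> J"
  from coeff_J[OF this, of 0] show False
    using one_notin_maximal_prod[of 0] by simp
qed

section \<open>Homogeneous components of elements of the Rees ring\<close>

lemma rees_split:
  assumes p: "p \<in> carrier A"
  obtains q where "q \<in> carrier A" "p = q \<oplus>\<^bsub>A\<^esub> mnm (cof p n) n"
    "\<forall>i. cof q i = (if i = n then \<zero> else cof p i)"
proof
  let ?q = "p \<ominus>\<^bsub>UP R\<^esub> mnm (cof p n) n"
  have pP: "p \<in> carrier (UP R)" and pI: "\<And>i. cof p i \<in> I i"
    using p by (simp_all add: mem_rees_iff)
  have c: "cof p i \<in> carrier R" for i
    using pI by (rule filtration_carrier)
  have qP: "?q \<in> carrier (UP R)"
    using pP c by simp
  have coeff_q: "cof ?q i = (if i = n then \<zero> else cof p i)" for i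
    using pP c by (simp add: a_minus_def r_neg)
  then show "\<forall>i. cof ?q i = (if i = n then \<zero> else cof p i)"
    by simp
  show "?q \<in> carrier A"
    unfolding mem_rees_iff coeff_q using qP pI filtration_zero by simp
  show "p = ?q \<oplus>\<^bsub>A\<^esub> mnm (cof p n) n"
    unfolding rees_simps using pP qP c by (intro UP.up_eqI) (simp_all add: coeff_q)
qed

text \<open>Induction on the degree bound \<open>N\<close>: \<open>rees_split\<close> removes the
  term of degree \<open>N\<close>, and the remainder has bound \<open>N\<close>. Membership in an
  ideal can thus be checked on homogeneous elements.\<close>

lemma mem_ideal_if_components:
  assumes K: "ideal K A" and "p \<in> carrier A"
    and "\<And>i. mnm (cof p i) i \<in> K" "\<And>i. N \<le> i \<Longrightarrow> cof p i = \<zero>"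
  shows "p \<in> K"
  using assms(2-)
proof (induction N arbitrary: p)
  case 0
  then have "p = \<zero>\<^bsub>UP R\<^esub>"
    by (intro UP.up_eqI) (simp_all add: rees_closed)
  then show ?case
    using additive_subgroup.zero_closed[OF ideal.axioms(1)[OF K]] by simp
next
  case (Suc N)
  obtain q where q: "q \<in> carrier A" "p = q \<oplus>\<^bsub>A\<^esub> mnm (cof p N) N"
    "\<forall>i. cof q i = (if i = N then \<zero> else cof p i)"
    by (rule rees_split[OF Suc.prems(1), of N])
  have "\<zero>\<^bsub>UP R\<^esub> \<in> K"
    using additive_subgroup.zero_closed[OF ideal.axioms(1)[OF K]] by simp
  then have "mnm (cof q i) i \<in> K" for i
    using q(3)[rule_format, of i] Suc.prems(2)[of i] by simp
  moreover have "cof q i = \<zero>" if "N \<le> i" for i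
    using q(3)[rule_format, of i] Suc.prems(3)[of i] that by (cases "i = N") simp_all
  ultimately have "q \<in> K"
    by (rule Suc.IH[OF q(1)])
  from additive_subgroup.a_closed[OF ideal.axioms(1)[OF K] this Suc.prems(2)[of N]]
  show ?case
    using q(2) by simp
qed

section \<open>The quotient by the extended maximal ideal and the two implications\<close>

lemma quot_hom: "ring_hom_cring A (A Quot J) ((+>\<^bsub>A\<^esub>) J)"
  by (rule ideal.rcos_ring_hom_cring[OF J_ideal rees_cring])

lemma quot_eq_zero:
  assumes "p \<in> J"
  shows "J +>\<^bsub>A\<^esub> p = \<zero>\<^bsub>A Quot J\<^esub>"
  using A.a_rcos_zero[OF J_ideal assms] by (simp add: FactRing_def)

text \<open>
  With \<open>x = f t\<^sup>n\<close>, comparing the components of degree \<open>k n\<close> in \<open>x\<^sup>k = x\<^bsup>k + 1\<^esup> y\<close> modulo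
  \<open>M R[I]\<close> leaves only \<open>f\<^sup>k \<in> M I\<^bsub>k n\<^esub>\<close>, since \<open>n > 0\<close>.
\<close>
lemma pow_mem_if_krull_dim_0:
  assumes dim: "krull_dim (A Quot J) = 0" and n: "n > 0" and f: "f \<in> I n"
  shows "\<exists>m>0. f [^] (m::nat) \<in> ideal_prod R M (I (m * n))"
proof -
  interpret h: ring_hom_cring A "A Quot J" "(+>\<^bsub>A\<^esub>) J"
    by (rule quot_hom)
  let ?x = "mnm f n"
  note fR = filtration_carrier[OF f]
  have x: "?x \<in> carrier A"
    by (rule monom_in_rees[OF f])
  obtain k :: nat and Y where Y: "Y \<in> carrier (A Quot J)"
    and eq: "(J +>\<^bsub>A\<^esub> ?x) [^]\<^bsub>A Quot J\<^esub> k =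
      (J +>\<^bsub>A\<^esub> ?x) [^]\<^bsub>A Quot J\<^esub> Suc k \<otimes>\<^bsub>A Quot J\<^esub> Y"
    using cring.krull_dim_0_imp_pow_eq[OF h.S.is_cring dim h.hom_closed[OF x]] by blast
  from Y obtain y where y: "y \<in> carrier A" "Y = J +>\<^bsub>A\<^esub> y"
    unfolding FactRing_def A_RCOSETS_def' by auto
  have xk: "?x [^]\<^bsub>A\<^esub> k \<in> carrier A" "?x [^]\<^bsub>A\<^esub> Suc k \<in> carrier A"
    by (rule A.nat_pow_closed[OF x])+
  have "J +>\<^bsub>A\<^esub> (?x [^]\<^bsub>A\<^esub> k) = J +>\<^bsub>A\<^esub> (?x [^]\<^bsub>A\<^esub> Suc k \<otimes>\<^bsub>A\<^esub> y)"
    unfolding h.hom_mult[OF xk(2) y(1)] h.hom_pow[OF x] using eq y by simp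
  \<comment> \<open>As a member of its own coset, x^k also lies in the coset of x^(k+1) y; this
    lifts the equation to the Rees ring up to an error j in \<open>J\<close>.\<close>
  moreover have "?x [^]\<^bsub>A\<^esub> k \<in> J +>\<^bsub>A\<^esub> (?x [^]\<^bsub>A\<^esub> k)"
    using abelian_subgroup.a_rcos_self[OF _ xk(1), of J] ideal.axioms(1)[OF J_ideal]
      abelian_subgroupI3 A.is_abelian_group by blast
  ultimately obtain j where j: "j \<in> J"
    "?x [^]\<^bsub>A\<^esub> k = j \<oplus>\<^bsub>A\<^esub> (?x [^]\<^bsub>A\<^esub> Suc k \<otimes>\<^bsub>A\<^esub> y)"
    unfolding a_r_coset_def' by blast
  have jc: "j \<in> carrier (UP R)"
    using ideal.Icarr[OF J_ideal j(1)] rees_closed by blast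
  have yc: "y \<in> carrier (UP R)"
    using y rees_closed by blast
  have "cof (mnm (f [^] Suc k) (n * Suc k) \<otimes>\<^bsub>UP R\<^esub> y) (n * k) = \<zero>"
  proof -
    have "cof (mnm (f [^] Suc k) (n * Suc k)) i \<otimes> cof y (n * k - i) = \<zero>"
      if "i \<in> {..n * k}" for i
    proof -
      have "n * Suc k \<noteq> i"
        using n that by simp
      then show ?thesis
        using fR yc by (simp del: nat_pow_Suc mult_Suc_right)
    qed
    \<comment> \<open>A sum of zeros vanishes because the zero ideal is closed under finite
      sums.\<close>
    then have "(\<Oplus>i\<in>{..n * k}. cof (mnm (f [^] Suc k) (n * Suc k)) i \<otimes> cof y (n * k - i)) \<in> {\<zero>}"
      by (intro finsum_in_ideal[OF zeroideal]) simp_all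
    then show ?thesis
      using fR yc by (simp del: nat_pow_Suc mult_Suc_right UP.coeff_monom)
  qed
  moreover have "mnm (f [^] k) (n * k) = j \<oplus>\<^bsub>UP R\<^esub> (mnm (f [^] Suc k) (n * Suc k) \<otimes>\<^bsub>UP R\<^esub> y)"
    using j(2) unfolding rees_simps rees_pow UP.monom_pow[OF fR] .
  then have "cof (mnm (f [^] k) (n * k)) (n * k) =
      cof j (n * k) \<oplus> cof (mnm (f [^] Suc k) (n * Suc k) \<otimes>\<^bsub>UP R\<^esub> y) (n * k)"
    using fR jc yc by (simp del: nat_pow_Suc mult_Suc_right UP.coeff_monom UP.coeff_mult)
  ultimately have "f [^] k = cof j (n * k)"
    using fR jc by simp
  then have fk: "f [^] k \<in> ideal_prod R M (I (k * n))"
    using coeff_J[OF j(1), of "n * k"] by (simp add: mult.commute)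
  \<comment> \<open>For k = 0 the membership just proved would read 1 in M I_0.\<close>
  moreover have "k \<noteq> 0"
  proof
    assume "k = 0"
    then show False
      using fk one_notin_maximal_prod[of 0] by simp
  qed
  ultimately show ?thesis
    by blast
qed

text \<open>
  Every prime \<open>P\<close> contains the nilpotent components of positive degree, and \<open>R/M\<close> is a field,
  so \<open>R[I]/M R[I]\<close> has exactly one prime.
\<close>
lemma krull_dim_0_if_pow_mem:
  assumes nil: "\<And>n f. \<lbrakk>n > 0; f \<in> I n\<rbrakk> \<Longrightarrow> \<exists>m>0. f [^] (m::nat) \<in> ideal_prod R M (I (m * n))"
  shows "krull_dim (A Quot J) = 0"
proof -
  interpret h: ring_hom_cring A "A Quot J" "(+>\<^bsub>A\<^esub>) J"
    by (rule quot_hom)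
  \<comment> \<open>The preimage \<open>?K\<close> of P is an ideal of the Rees ring, so the
    components of q can be treated one by one. A component of positive degree has a power in
    \<open>J\<close>, hence its class has a power in the prime P.\<close>
  have positive: "J +>\<^bsub>A\<^esub> q \<in> P"
    if P: "primeideal P (A Quot J)" and q: "q \<in> carrier A" "cof q 0 = \<zero>" for P q
  proof -
    interpret P: primeideal P "A Quot J" by fact
    let ?K = "{r \<in> carrier A. J +>\<^bsub>A\<^esub> r \<in> P}"
    have K: "ideal ?K A"
      by (rule ring_hom_ring.ideal_vimage[OF ideal.rcos_ring_hom_ring[OF J_ideal] P.is_ideal])
    have mon: "mnm (cof q i) i \<in> ?K" for i
    proof (cases "i = 0")
      case True
      then show ?thesis
        using q additive_subgroup.zero_closed[OF ideal.axioms(1)[OF K]] by simp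
    next
      case False
      let ?f = "cof q i"
      have f: "?f \<in> I i"
        using q by (simp add: mem_rees_iff)
      note x = monom_in_rees[OF f]
      obtain m :: nat where m: "?f [^] m \<in> ideal_prod R M (I (m * i))"
        using nil[of i ?f] f False by blast
      have "mnm ?f i [^]\<^bsub>A\<^esub> m \<in> J"
        using monom_in_J[OF m] UP.monom_pow[of ?f i m] filtration_carrier[OF f]
        by (simp add: mult.commute)
      then have "(J +>\<^bsub>A\<^esub> mnm ?f i) [^]\<^bsub>A Quot J\<^esub> m \<in> P"
        using h.hom_pow[OF x, of m] quot_eq_zero P.zero_closed by simp
      then show ?thesis
        using P.pow_memD h.hom_closed[OF x] x by blast
    qed
    have "cof q i = \<zero>" if "Suc (deg R q) \<le> i" for i
      using UP.deg_aboveD[of q i] that rees_closed[OF q(1)] by simp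
    then have "q \<in> ?K"
      by (rule mem_ideal_if_components[OF K q(1) mon])
    then show ?thesis by simp
  qed
  \<comment> \<open>An element b of Q is split into its constant term c and a rest whose class lies
    in P by \<open>positive\<close>. It remains to show that c is in M, so that its class is
    zero.\<close>
  have sub: "Q \<subseteq> P" if P: "primeideal P (A Quot J)" and Q: "primeideal Q (A Quot J)"
    and PQ: "P \<subseteq> Q" for P Q
  proof
    interpret P: primeideal P "A Quot J" by fact
    interpret Q: primeideal Q "A Quot J" by fact
    fix b assume b: "b \<in> Q"
    then obtain p where p: "p \<in> carrier A" "b = J +>\<^bsub>A\<^esub> p"
      using Q.Icarr unfolding FactRing_def A_RCOSETS_def' by auto
    obtain q where q: "q \<in> carrier A" "p = q \<oplus>\<^bsub>A\<^esub> mnm (cof p 0) 0"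
      "\<forall>i. cof q i = (if i = 0 then \<zero> else cof p i)"
      by (rule rees_split[OF p(1), of 0])
    let ?c = "cof p 0"
    have c: "?c \<in> carrier R"
      using p rees_closed by simp
    have cA: "mnm ?c 0 \<in> carrier A"
      using monom_in_rees[of ?c 0] c filtration_0 by simp
    have qP: "J +>\<^bsub>A\<^esub> q \<in> P"
      using positive[OF P q(1)] q(3) by simp
    have b_eq: "b = (J +>\<^bsub>A\<^esub> q) \<oplus>\<^bsub>A Quot J\<^esub> (J +>\<^bsub>A\<^esub> mnm ?c 0)"
      using p(2) arg_cong[OF q(2), of "(+>\<^bsub>A\<^esub>) J"] h.hom_add[OF q(1) cA] by simp
    \<comment> \<open>The class of c is the difference of b and an element of P, so it lies in Q; if
      c were a unit of R, then Q would contain 1.\<close>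
    have "?c \<in> M"
    proof (rule ccontr)
      assume "?c \<notin> M"
      then obtain d where d: "d \<in> carrier R" "d \<otimes> ?c = \<one>"
        using inverse_if_notin_maximal c by blast
      have dA: "mnm d 0 \<in> carrier A"
        using monom_in_rees[of d 0] d filtration_0 by simp
      have "J +>\<^bsub>A\<^esub> mnm ?c 0 = \<ominus>\<^bsub>A Quot J\<^esub> (J +>\<^bsub>A\<^esub> q) \<oplus>\<^bsub>A Quot J\<^esub> b"
        unfolding b_eq using h.hom_closed[OF q(1)] h.hom_closed[OF cA] by (simp add: h.S.r_neg1)
      also have "\<dots> \<in> Q"
        using qP PQ b by blast
      finally have "(J +>\<^bsub>A\<^esub> mnm d 0) \<otimes>\<^bsub>A Quot J\<^esub> (J +>\<^bsub>A\<^esub> mnm ?c 0) \<in> Q"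
        using Q.I_l_closed h.hom_closed[OF dA] by blast
      also have "(J +>\<^bsub>A\<^esub> mnm d 0) \<otimes>\<^bsub>A Quot J\<^esub> (J +>\<^bsub>A\<^esub> mnm ?c 0) =
          J +>\<^bsub>A\<^esub> (mnm d 0 \<otimes>\<^bsub>A\<^esub> mnm ?c 0)"
        using h.hom_mult[OF dA cA] by simp
      also have "mnm d 0 \<otimes>\<^bsub>A\<^esub> mnm ?c 0 = \<one>\<^bsub>A\<^esub>"
        using d c UP.monom_mult[of d ?c 0 0] UP.monom_one by simp
      finally show False
        using Q.one_imp_carrier Q.I_notcarr h.hom_one by simp
    qed
    then have "mnm ?c 0 \<in> J"
      by (rule const_in_J)
    then have "b = J +>\<^bsub>A\<^esub> q"
      using b_eq quot_eq_zero h.hom_closed[OF q(1)] by simp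
    with qP show "b \<in> P" by simp
  qed
  \<comment> \<open>The quotient is not the zero ring, so it has a maximal ideal, which supplies the
    prime required for dimension 0.\<close>
  have "\<one>\<^bsub>A Quot J\<^esub> \<notin> {\<zero>\<^bsub>A Quot J\<^esub>}"
    using one_notin_J ideal.rcos_const_imp_mem[OF J_ideal A.one_closed] h.hom_one
    by (auto simp: FactRing_def)
  then obtain P where "maximalideal P (A Quot J)"
    using cring.maximalideal_exists[OF h.S.is_cring h.S.zeroideal] by blast
  then show ?thesis
    unfolding krull_dim_eq_0_iff using cring.maximalideal_prime[OF h.S.is_cring] sub by blast
qed

end

theorem lemma3p8:
  fixes R (structure) and M :: "'a set" and I :: "nat \<Rightarrow> 'a set"
  assumes "local_noetherian_ring R M"
    and "ring_filtration R I"
  shows "analytic_spread R M I = 0 \<longleftrightarrow>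
    (\<forall>n>0. \<forall>f\<in>I n. \<exists>m>0. f [^] (m::nat) \<in> ideal_prod R M (I (m * n)))"
proof -
  interpret local_filtration R M I
    using assms by (rule local_filtration.intro)
  show ?thesis
    unfolding analytic_spread_def
    using pow_mem_if_krull_dim_0 krull_dim_0_if_pow_mem by blast
qed

end
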